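(* Let $q\in\mathbb{C}$ with $0<|q|<1$, let $\alpha\in\mathbb{N}$, $m\in\mathbb{N}$, $n\in\mathbb{N}_0$ and $x,y\in\mathbb{C}$. Then the $q$-Genocchi polynomials of order $\alpha$ and the $q$-Bernoulli polynomials satisfy $$\mathfrak{G}_{n,q}^{(\alpha)}(x,y)=\sum_{k=0}^{n}\begin{bmatrix} n \\ k \end{bmatrix}_q\frac{1}{m^{n-k-1}[k+1]_q}\left[2[k+1]_q\sum_{j=0}^{k}\begin{bmatrix} k \\ j \end{bmatrix}_q\left(\frac1m-1\right)_q^{k-j}\mathfrak{G}_{j,q}^{(\alpha-1)}(0,y)-\sum_{j=0}^{k+1}\begin{bmatrix} k+1 \\ j \end{bmatrix}_q\left(\frac1m-1\right)_q^{k+1-j}\mathfrak{G}_{j,q}^{(\alpha)}(0,y)-\mathfrak{G}_{k+1,q}^{(\alpha)}(0,y)\right]\mathfrak{B}_{n-k,q}(mx,0).$$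
   Context: $\mathbb{N}=\{1,2,\dots\}$, $\mathbb{N}_0=\{0,1,2,\dots\}$. For $0<|q|<1$: $[a]_q=\frac{1-q^a}{1-q}$, $[0]_q!=1$, $[n]_q!=[1]_q[2]_q\cdots[n]_q$, and $\begin{bmatrix} n \\ k \end{bmatrix}_q=\frac{[n]_q!}{[k]_q!\,[n-k]_q!}$. The $q$-analogue of $(a+b)^n$ is $$(a+b)_q^n:=\sum_{k=0}^n\begin{bmatrix} n \\ k \end{bmatrix}_q q^{k(k-1)/2}a^{n-k}b^k,\qquad n\in\mathbb{N}_0,$$ and $\left(\frac1m-1\right)_q^n$ means this expression with $a=\frac1m$, $b=-1$. The two $q$-exponential functions are $$e_q(z)=\sum_{n=0}^\infty\frac{z^n}{[n]_q!},\qquad E_q(z)=\sum_{n=0}^\infty\frac{q^{n(n-1)/2}z^n}{[n]_q!}.$$ For $\alpha\in\mathbb{N}_0$ the $q$-Genocchi polynomials $\mathfrak{G}_{n,q}^{(\alpha)}(x,y)$ of order $\alpha$ and the $q$-Bernoulli polynomials $\mathfrak{B}_{n,q}^{(\alpha)}(x,y)$ of order $\alpha$ are defined by the power series expansions in $t$ at $t=0$ $$\left(\frac{2t}{e_q(t)+1}\right)^{\alpha}e_q(tx)E_q(ty)=\sum_{n=0}^\infty\mathfrak{G}_{n,q}^{(\alpha)}(x,y)\frac{t^n}{[n]_q!},\qquad \left(\frac{t}{e_q(t)-1}\right)^{\alpha}e_q(tx)E_q(ty)=\sum_{n=0}^\infty\mathfrak{B}_{n,q}^{(\alpha)}(x,y)\frac{t^n}{[n]_q!}.$$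 When the superscript is omitted, the order is $\alpha=1$: $\mathfrak{B}_{n,q}(x,y)=\mathfrak{B}_{n,q}^{(1)}(x,y)$. *)

theory Defs
  imports "HOL-Complex_Analysis.Complex_Analysis"
begin

definition q_bracket :: "complex \<Rightarrow> nat \<Rightarrow> complex" where
  "q_bracket q a = (1 - q ^ a) / (1 - q)"

definition q_fact :: "complex \<Rightarrow> nat \<Rightarrow> complex" where
  "q_fact q n = (\<Prod>i=1..n. q_bracket q i)"

text \<open>Only meaningful for \<open>k \<le> n\<close>, since \<open>n - k\<close> is truncated subtraction.\<close>

definition q_binomial :: "complex \<Rightarrow> nat \<Rightarrow> nat \<Rightarrow> complex" where
  "q_binomial q n k = q_fact q n / (q_fact q k * q_fact q (n - k))"

text \<open>\<open>q_add_power q a b n\<close> is the \<open>q\<close>-analogue of \<open>(a + b) ^ n\<close>; it is not a function of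
  the sum \<open>a + b\<close> alone.\<close>

definition q_add_power :: "complex \<Rightarrow> complex \<Rightarrow> complex \<Rightarrow> nat \<Rightarrow> complex" where
  "q_add_power q a b n =
     (\<Sum>k=0..n. q_binomial q n k * q ^ (k * (k - 1) div 2) * a ^ (n - k) * b ^ k)"

text \<open>For \<open>0 < norm q < 1\<close> the first series converges only for \<open>norm z < 1 / norm (1 - q)\<close>;
  outside its disc of convergence the value is unspecified and never used, because only
  expansions at \<open>0\<close> are taken below.\<close>

definition q_exp_small :: "complex \<Rightarrow> complex \<Rightarrow> complex" where
  "q_exp_small q z = (\<Sum>n. z ^ n / q_fact q n)"

definition q_exp_big :: "complex \<Rightarrow> complex \<Rightarrow> complex" where
  "q_exp_big q z = (\<Sum>n. q ^ (n * (n - 1) div 2) * z ^ n / q_fact q n)"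

text \<open>The numbers \<open>g n\<close> in the expansion \<open>f t = (\<Sum>n. g n * t ^ n / q_fact q n)\<close> at \<open>t = 0\<close>.
  Removable singularities are filled in first: \<open>t / (q_exp_small q t - 1)\<close>
  has one at \<open>0\<close>, where HOL division gives \<open>0 / 0 = 0\<close> instead of the limit \<open>1\<close>.
  Functions analytic at \<open>0\<close> are not changed near \<open>0\<close> by \<open>remove_sings\<close>.\<close>

definition q_exp_coeff :: "complex \<Rightarrow> (complex \<Rightarrow> complex) \<Rightarrow> nat \<Rightarrow> complex" where
  "q_exp_coeff q f n = q_fact q n * fps_nth (fps_expansion (remove_sings f) 0) n"

definition q_genocchi :: "complex \<Rightarrow> nat \<Rightarrow> nat \<Rightarrow> complex \<Rightarrow> complex \<Rightarrow> complex" where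
  "q_genocchi q \<alpha> n x y =
     q_exp_coeff q
       (\<lambda>t. (2 * t / (q_exp_small q t + 1)) ^ \<alpha> * q_exp_small q (t * x) * q_exp_big q (t * y)) n"

definition q_bernoulli :: "complex \<Rightarrow> nat \<Rightarrow> nat \<Rightarrow> complex \<Rightarrow> complex \<Rightarrow> complex" where
  "q_bernoulli q \<alpha> n x y =
     q_exp_coeff q
       (\<lambda>t. (t / (q_exp_small q t - 1)) ^ \<alpha> * q_exp_small q (t * x) * q_exp_big q (t * y)) n"

end

theory Submission
  imports Defs
begin

text \<open>
  All generating functions are handled as formal power series. With \<open>e\<close>, \<open>E\<close> the two
  \<open>q\<close>-exponential series, \<open>A(t) = e(t/m) E(-t)\<close> generates the numbers
  \<open>(1/m - 1)\<^sub>q\<^sup>n\<close>, and \<open>e(t) E(-t) = 1\<close>. Put \<open>H\<^sub>\<alpha>(t) = (2t/(e(t)+1))\<^sup>\<alpha> E(ty)\<close>. Since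
  \<open>2t H\<^bsub>\<alpha>-1\<^esub> = (e(t)+1) H\<^sub>\<alpha>\<close>, the bracket in the theorem is \<open>[k+1]\<^sub>q!\<close> times the coefficient of
  \<open>t\<^bsup>k+1\<^esup>\<close> in \<open>A (e+1) H\<^sub>\<alpha> - A H\<^sub>\<alpha> - H\<^sub>\<alpha> = (e(t/m) - 1) H\<^sub>\<alpha>\<close>. Multiplying by the Bernoulli
  generating function at \<open>t/m\<close> cancels \<open>e(t/m) - 1\<close> and leaves \<open>H\<^sub>\<alpha> e(tx)\<close>.
\<close>

subsection \<open>The \<open>q\<close>-factorial\<close>

lemma one_minus_power_neq_0:
  fixes q :: complex
  assumes "norm q < 1" "n \<ge> 1"
  shows "1 - q ^ n \<noteq> 0"
proof
  assume "1 - q ^ n = 0"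
  then have "norm q ^ n = 1"
    by (metis eq_iff_diff_eq_0 norm_one norm_power)
  moreover have "norm q ^ n < 1"
    using assms by (simp add: power_less_one_iff)
  ultimately show False by simp
qed

lemma q_bracket_neq_0:
  assumes "norm q < 1" "n \<ge> 1"
  shows "q_bracket q n \<noteq> 0"
  using one_minus_power_neq_0[OF assms] one_minus_power_neq_0[of q 1] assms
  by (auto simp: q_bracket_def)

lemma q_fact_0 [simp]: "q_fact q 0 = 1"
  by (simp add: q_fact_def)

lemma q_fact_Suc: "q_fact q (Suc n) = q_fact q n * q_bracket q (Suc n)"
  by (simp add: q_fact_def)

lemma q_fact_neq_0:
  assumes "norm q < 1"
  shows "q_fact q n \<noteq> 0"
  using assms by (induction n) (auto simp: q_fact_Suc q_bracket_neq_0)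

text \<open>For \<open>i >= 1\<close> the reverse triangle inequality gives
  \<open>|1 - q^i| >= 1 - |q|\<close>. This geometric lower bound yields the positive radii of
  convergence below.\<close>

lemma norm_q_fact_ge:
  assumes "norm q < 1"
  shows "((1 - norm q) / norm (1 - q)) ^ n \<le> norm (q_fact q n)"
proof (induction n)
  case (Suc n)
  have "1 - norm q \<le> 1 - norm (q ^ Suc n)"
    using assms by (simp add: norm_mult norm_power mult_left_le power_le_one)
  also have "\<dots> \<le> norm (1 - q ^ Suc n)"
    using norm_triangle_ineq2[of 1 "q ^ Suc n"] by simp
  finally have "(1 - norm q) / norm (1 - q) \<le> norm (q_bracket q (Suc n))"
    unfolding q_bracket_def norm_divide by (intro divide_right_mono) auto
  with Suc show ?case
    unfolding q_fact_Suc norm_mult power_Suc2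
    using assms by (intro mult_mono) auto
qed simp

text \<open>Lets every \<open>q\<close>-binomial convolution be read as a product of formal power
  series.\<close>

lemma q_fact_mult_fps_nth:
  assumes "norm q < 1"
  shows "q_fact q n * fps_nth (F * G) n =
    (\<Sum>k=0..n. q_binomial q n k * (q_fact q k * fps_nth F k) * (q_fact q (n - k) * fps_nth G (n - k)))"
  unfolding fps_mult_nth sum_distrib_left
  by (intro sum.cong) (auto simp: q_binomial_def q_fact_neq_0[OF assms])

subsection \<open>The \<open>q\<close>-exponential series\<close>

abbreviation dilate :: "complex \<Rightarrow> complex fps \<Rightarrow> complex fps" where
  "dilate c F \<equiv> F oo (fps_const c * fps_X)"

lemma dilate_mult: "dilate c (F * G) = dilate c F * dilate c G"
  by (simp add: fps_compose_mult_distrib)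

lemma dilate_inverse:
  assumes "fps_nth F 0 \<noteq> 0"
  shows "dilate c (inverse F) = inverse (dilate c F)"
  using assms by (simp add: fps_inverse_compose)

lemma dilate_dilate: "dilate c (dilate d F) = dilate (c * d) F"
  by (intro fps_ext) (simp add: fps_nth_compose_linear power_mult_distrib)

definition q_exp_fps :: "complex \<Rightarrow> complex fps" where
  "q_exp_fps q = Abs_fps (\<lambda>n. 1 / q_fact q n)"

definition q_Exp_fps :: "complex \<Rightarrow> complex fps" where
  "q_Exp_fps q = Abs_fps (\<lambda>n. q ^ (n * (n - 1) div 2) / q_fact q n)"

lemma q_exp_fps_nth [simp]: "fps_nth (q_exp_fps q) n = 1 / q_fact q n"
  by (simp add: q_exp_fps_def)

lemma q_Exp_fps_nth [simp]:
  "fps_nth (q_Exp_fps q) n = q ^ (n * (n - 1) div 2) / q_fact q n"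
  by (simp add: q_Exp_fps_def)

text \<open>Serves both exponentials at once: their coefficients times \<open>q_fact q n\<close> are
  1 and a power of \<open>q\<close>.\<close>

lemma fps_conv_radius_pos_of_q_fact_bound:
  assumes q: "norm q < 1"
    and F: "\<And>n. norm (fps_nth F n * q_fact q n) \<le> 1"
  shows "fps_conv_radius F > 0"
proof -
  define c where "c = (1 - norm q) / norm (1 - q)"
  have "1 - q \<noteq> 0"
    using q by auto
  then have c: "c > 0"
    using q by (simp add: c_def)
  \<comment> \<open>At half the base \<open>c\<close> of the lower bound for \<open>q_fact\<close>,
    the terms are dominated by \<open>(1/2)^n\<close>.\<close>
  have "summable (\<lambda>n. fps_nth F n * of_real (c / 2) ^ n)"
  proof (rule summable_comparison_test')
    show "summable (\<lambda>n. (1 / 2 :: real) ^ n)"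
      by (rule summable_geometric) simp
    fix n :: nat
    have "norm (fps_nth F n) * c ^ n \<le> norm (fps_nth F n) * norm (q_fact q n)"
      unfolding c_def by (intro mult_left_mono norm_q_fact_ge q) auto
    also have "\<dots> \<le> 1"
      using F[of n] by (simp add: norm_mult)
    finally show "norm (fps_nth F n * of_real (c / 2) ^ n) \<le> (1 / 2) ^ n"
      using c by (simp add: norm_mult norm_power norm_divide power_divide field_simps)
  qed
  then have "conv_radius (fps_nth F) \<ge> norm (of_real (c / 2) :: complex)"
    by (rule conv_radius_geI)
  moreover have "ereal (norm (of_real (c / 2) :: complex)) > 0"
    using c by simp
  ultimately show ?thesis
    unfolding fps_conv_radius_def by order
qed

lemma q_exp_small_has_fps_expansion:
  assumes "norm q < 1"
  shows "q_exp_small q has_fps_expansion q_exp_fps q"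
proof -
  have "q_exp_small q = eval_fps (q_exp_fps q)"
    by (simp add: fun_eq_iff q_exp_small_def eval_fps_def)
  moreover have "fps_conv_radius (q_exp_fps q) > 0"
    using assms by (intro fps_conv_radius_pos_of_q_fact_bound) (auto simp: q_fact_neq_0)
  ultimately show ?thesis
    by (simp add: eval_fps_has_fps_expansion)
qed

lemma q_exp_big_has_fps_expansion:
  assumes "norm q < 1"
  shows "q_exp_big q has_fps_expansion q_Exp_fps q"
proof -
  have "q_exp_big q = eval_fps (q_Exp_fps q)"
    by (simp add: fun_eq_iff q_exp_big_def eval_fps_def)
  moreover have "fps_conv_radius (q_Exp_fps q) > 0"
    using assms by (intro fps_conv_radius_pos_of_q_fact_bound)
      (auto simp: q_fact_neq_0 norm_power power_le_one)
  ultimately show ?thesis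
    by (simp add: eval_fps_has_fps_expansion)
qed

lemma has_fps_expansion_dilate:
  assumes "f has_fps_expansion F"
  shows "(\<lambda>t. f (t * c)) has_fps_expansion dilate c F"
proof -
  have "(\<lambda>t. c * t) has_fps_expansion fps_const c * fps_X"
    by (intro fps_expansion_intros)
  from has_fps_expansion_compose[OF assms this] show ?thesis
    by (simp add: o_def mult.commute)
qed

text \<open>In degree \<open>n\<close> this is \<open>1 - q^n = (1 - q) [n]_q\<close>, divided by
  \<open>[n]_q!\<close>.\<close>

lemma q_exp_fps_dilate:
  assumes "norm q < 1"
  shows "dilate q (q_exp_fps q) = q_exp_fps q * (1 - fps_const (1 - q) * fps_X)"
proof (rule fps_ext)
  fix n
  show "fps_nth (dilate q (q_exp_fps q)) n =
        fps_nth (q_exp_fps q * (1 - fps_const (1 - q) * fps_X)) n"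
  proof (cases n)
    case (Suc k)
    have "1 - q * q ^ k \<noteq> 0" "1 - q \<noteq> 0"
      using one_minus_power_neq_0[OF assms, of "Suc k"] one_minus_power_neq_0[OF assms, of 1]
      by auto
    then have "q * q ^ k / (f * ((1 - q * q ^ k) / (1 - q)))
        = 1 / (f * ((1 - q * q ^ k) / (1 - q))) - (1 - q) * (1 / f)" if "f \<noteq> 0" for f
      using that by (simp add: divide_simps) (simp add: algebra_simps)
    moreover have "q_exp_fps q * (1 - fps_const (1 - q) * fps_X)
        = q_exp_fps q - fps_const (1 - q) * (fps_X * q_exp_fps q)"
      by (simp only: right_diff_distrib mult_1_right mult_1_left mult_ac)
    ultimately show ?thesis
      using q_fact_neq_0[OF assms, of k] Suc
      by (simp add: fps_nth_compose_linear q_fact_Suc q_bracket_def)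
  qed (simp add: fps_nth_compose_linear)
qed

lemma q_Exp_fps_dilate:
  assumes "norm q < 1"
  shows "q_Exp_fps q = dilate q (q_Exp_fps q) * (1 + fps_const (1 - q) * fps_X)"
proof (rule fps_ext)
  fix n
  show "fps_nth (q_Exp_fps q) n =
        fps_nth (dilate q (q_Exp_fps q) * (1 + fps_const (1 - q) * fps_X)) n"
  proof (cases n)
    case (Suc k)
    have "1 - q * q ^ k \<noteq> 0" "1 - q \<noteq> 0"
      using one_minus_power_neq_0[OF assms, of "Suc k"] one_minus_power_neq_0[OF assms, of 1]
      by auto
    \<comment> \<open>Again \<open>1 - q^n = (1 - q) [n]_q\<close>, now with
      \<open>n = k + 1\<close>; \<open>f\<close> stands for \<open>q_fact q k\<close> and
      \<open>c\<close> for \<open>q^(k(k-1)/2)\<close>.\<close>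
    then have eq: "q ^ k * c / (f * ((1 - q * q ^ k) / (1 - q)))
        = q * q ^ k * (q ^ k * c / (f * ((1 - q * q ^ k) / (1 - q)))) + (1 - q) * (q ^ k * (c / f))"
      if "f \<noteq> 0" for c f
      using that by (simp add: divide_simps) (simp add: algebra_simps)
    \<comment> \<open>The triangular exponents of \<open>k + 1\<close> and \<open>k\<close> differ
      by \<open>k\<close>, whence the factor \<open>q^k\<close> in \<open>eq\<close>.\<close>
    have exponent: "(k + k * k) div 2 = k + k * (k - 1) div 2"
      by (cases k) auto
    have expand: "dilate q (q_Exp_fps q) * (1 + fps_const (1 - q) * fps_X)
        = dilate q (q_Exp_fps q) + fps_const (1 - q) * (fps_X * dilate q (q_Exp_fps q))"
      by (simp only: distrib_left mult_1_right mult_1_left mult_ac)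
    show ?thesis
      using eq[OF q_fact_neq_0[OF assms, of k], of "q ^ (k * (k - 1) div 2)"] Suc exponent
      unfolding expand
      by (simp only: fps_nth_compose_linear q_fact_Suc q_bracket_def power_add power_Suc
          q_Exp_fps_nth fps_add_nth fps_mult_left_const_nth fps_X_mult_nth diff_Suc_1 mult_Suc
          mult_Suc_right nat.distinct if_False mult.commute[of "Suc k" k])
  qed (simp add: fps_nth_compose_linear)
qed

text \<open>The functional equations show that the product is invariant under \<open>t \<mapsto> q t\<close>,
  hence constant.\<close>

lemma q_exp_fps_mult_q_Exp_fps_minus:
  assumes "norm q < 1"
  shows "q_exp_fps q * dilate (-1) (q_Exp_fps q) = 1"
proof -
  define P where "P = q_exp_fps q * dilate (-1) (q_Exp_fps q)"
  define L :: "complex fps" where "L = 1 - fps_const (1 - q) * fps_X"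
  \<comment> \<open>Reflection turns the factor in the equation for \<open>E\<close> into the one in
    the equation for \<open>e\<close>, so \<open>L\<close> can pass from one series to the
    other.\<close>
  have L: "dilate (-1) (1 + fps_const (1 - q) * fps_X) = L"
    by (simp add: L_def fps_compose_add_distrib fps_compose_mult_distrib flip: fps_const_neg)
  have "P = q_exp_fps q * (dilate (-1) (dilate q (q_Exp_fps q)) * L)"
    unfolding P_def by (subst q_Exp_fps_dilate[OF assms]) (simp only: dilate_mult L)
  also have "dilate (-1) (dilate q (q_Exp_fps q)) = dilate q (dilate (-1) (q_Exp_fps q))"
    by (simp only: dilate_dilate mult.commute[of q "-1"])
  also have "q_exp_fps q * (dilate q (dilate (-1) (q_Exp_fps q)) * L)
      = dilate q (q_exp_fps q) * dilate q (dilate (-1) (q_Exp_fps q))"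
    unfolding q_exp_fps_dilate[OF assms] L_def by (simp only: mult_ac)
  also have "\<dots> = dilate q P"
    by (simp add: P_def dilate_mult)
  finally have P: "P = dilate q P" .
  show ?thesis
    unfolding P_def[symmetric]
  proof (rule fps_ext)
    fix n
    show "fps_nth P n = fps_nth 1 n"
    proof (cases "n = 0")
      case False
      have "fps_nth P n = q ^ n * fps_nth P n"
        by (subst P) (simp add: fps_nth_compose_linear)
      then have "(1 - q ^ n) * fps_nth P n = 0"
        by (simp add: algebra_simps)
      then show ?thesis
        using one_minus_power_neq_0[OF assms, of n] False by auto
    qed (simp add: P_def)
  qed
qed

lemma q_add_power_eq_fps_nth:
  assumes "norm q < 1"
  shows "q_add_power q a b n =
    q_fact q n * fps_nth (dilate a (q_exp_fps q) * dilate b (q_Exp_fps q)) n"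
  \<comment> \<open>In \<open>q_add_power\<close> the summation index is the exponent of
    \<open>b\<close>, so the \<open>E\<close> factor must come first in the Cauchy product.\<close>
  unfolding mult.commute[of "dilate a _"] q_fact_mult_fps_nth[OF assms] q_add_power_def
  by (intro sum.cong) (auto simp: fps_nth_compose_linear q_fact_neq_0[OF assms])

subsection \<open>Generating functions\<close>

text \<open>\<open>remove_sings\<close> depends only on values in punctured neighbourhoods, so the
  HOL value of \<open>f\<close> at 0, possibly a spurious \<open>0 / 0\<close>, is
  irrelevant.\<close>

lemma q_exp_coeff_eqI:
  assumes "g has_fps_expansion F" "\<And>t. t \<noteq> 0 \<Longrightarrow> f t = g t"
  shows "q_exp_coeff q f n = q_fact q n * fps_nth F n"
proof -
  have g: "g analytic_on {0}"
    using assms(1) by (rule has_fps_expansion_imp_analytic_0)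
  have "remove_sings f z = remove_sings g z" for z
  proof (rule remove_sings_cong)
    show "eventually (\<lambda>x. f x = g x) (at z)"
    proof (cases "z = 0")
      case True
      then show ?thesis using assms(2) by (auto simp: eventually_at_filter)
    next
      case False
      then have "eventually (\<lambda>x. x \<in> - {0}) (nhds z)"
        by (intro eventually_nhds_in_open) auto
      then show ?thesis
        by (auto simp: eventually_at_filter assms(2) elim: eventually_mono)
    qed
  qed auto
  then have "eventually (\<lambda>z. remove_sings f z = g z) (nhds 0)"
    using eventually_remove_sings_eq_nhds[OF g] by (auto elim!: eventually_mono)
  then have "remove_sings f has_fps_expansion F"
    using assms(1) has_fps_expansion_cong by blast
  then show ?thesis
    by (simp add: q_exp_coeff_def fps_expansion_eqI)
qed

text \<open>The series \<open>H\<close> of the overview, that is, the Genocchi generating function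
  at \<open>x = 0\<close>.\<close>

definition q_genocchi_fps :: "complex \<Rightarrow> nat \<Rightarrow> complex \<Rightarrow> complex fps" where
  "q_genocchi_fps q \<alpha> y =
     (2 * fps_X * inverse (q_exp_fps q + 1)) ^ \<alpha> * dilate y (q_Exp_fps q)"

lemma q_genocchi_fps_Suc:
  "(q_exp_fps q + 1) * q_genocchi_fps q (Suc \<alpha>) y = 2 * fps_X * q_genocchi_fps q \<alpha> y"
proof -
  have "inverse (q_exp_fps q + 1) * (q_exp_fps q + 1) = 1"
    by (rule inverse_mult_eq_1) simp
  moreover have "(q_exp_fps q + 1) * q_genocchi_fps q (Suc \<alpha>) y
      = (inverse (q_exp_fps q + 1) * (q_exp_fps q + 1)) * (2 * fps_X * q_genocchi_fps q \<alpha> y)"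
    unfolding q_genocchi_fps_def power_Suc by (simp only: mult_ac)
  ultimately show ?thesis
    by simp
qed

lemma q_genocchi_eq_fps_nth:
  assumes "norm q < 1"
  shows "q_genocchi q \<alpha> n x y =
    q_fact q n * fps_nth (q_genocchi_fps q \<alpha> y * dilate x (q_exp_fps q)) n"
proof -
  note e = q_exp_small_has_fps_expansion[OF assms] and E = q_exp_big_has_fps_expansion[OF assms]
  have "(\<lambda>t. (2 * t * inverse (q_exp_small q t + 1)) ^ \<alpha> * q_exp_small q (t * x) * q_exp_big q (t * y))
    has_fps_expansion (2 * fps_X * inverse (q_exp_fps q + 1)) ^ \<alpha>
      * dilate x (q_exp_fps q) * dilate y (q_Exp_fps q)"
    by (intro has_fps_expansion_mult has_fps_expansion_power has_fps_expansion_inverse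
        has_fps_expansion_add has_fps_expansion_numeral has_fps_expansion_fps_X
        has_fps_expansion_1 has_fps_expansion_dilate e E) simp
  from q_exp_coeff_eqI[OF this] show ?thesis
    unfolding q_genocchi_def q_genocchi_fps_def by (simp add: divide_inverse mult_ac)
qed

text \<open>Since \<open>e(t) - 1 = t D(t)\<close> with \<open>D\<close> the shifted series and
  \<open>D(0) = 1\<close>, the Bernoulli factor \<open>t / (e(t) - 1)\<close> is
  \<open>1 / D(t)\<close>.\<close>

lemma q_bernoulli_eq_fps_nth:
  assumes "norm q < 1"
  shows "q_bernoulli q 1 n x 0 =
    q_fact q n * fps_nth (inverse (fps_shift 1 (q_exp_fps q)) * dilate x (q_exp_fps q)) n"
proof -
  note e = q_exp_small_has_fps_expansion[OF assms] and E = q_exp_big_has_fps_expansion[OF assms]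
  \<comment> \<open>The value 1 at 0 is the limit of the quotient, namely the linear coefficient of
    \<open>e\<close>.\<close>
  define d where "d = (\<lambda>t. if t = 0 then 1 else (q_exp_small q t - 1) / t ^ 1)"
  have nz: "1 - q \<noteq> 0"
    using one_minus_power_neq_0[OF assms, of 1] by simp
  have D: "fps_nth (q_exp_fps q) 1 = 1"
    using nz by (simp add: q_fact_def q_bracket_def)
  have "d has_fps_expansion fps_shift 1 (q_exp_fps q - 1)"
    unfolding d_def
  proof (rule has_fps_expansion_shift)
    show "1 \<le> subdegree (q_exp_fps q - 1)"
      using D by (intro subdegree_geI) (auto simp: fps_eq_iff intro!: exI[of _ 1])
  qed (use D in \<open>auto intro!: has_fps_expansion_diff e\<close>)
  also have "fps_shift 1 (q_exp_fps q - 1) = fps_shift 1 (q_exp_fps q)"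
    by (intro fps_ext) simp
  finally have d: "d has_fps_expansion fps_shift 1 (q_exp_fps q)" .
  have "(\<lambda>t. inverse (d t) * q_exp_small q (t * x) * q_exp_big q (t * 0))
    has_fps_expansion inverse (fps_shift 1 (q_exp_fps q))
      * dilate x (q_exp_fps q) * dilate 0 (q_Exp_fps q)"
    by (intro has_fps_expansion_mult has_fps_expansion_inverse has_fps_expansion_dilate e E d)
       (use D in simp)
  moreover have "dilate 0 (q_Exp_fps q) = 1"
    by (intro fps_ext) (simp add: fps_nth_compose_linear power_0_left)
  ultimately have "(\<lambda>t. inverse (d t) * q_exp_small q (t * x) * q_exp_big q (t * 0))
    has_fps_expansion inverse (fps_shift 1 (q_exp_fps q)) * dilate x (q_exp_fps q)"
    by simp
  from q_exp_coeff_eqI[OF this] show ?thesis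
    unfolding q_bernoulli_def by (simp add: d_def)
qed

text \<open>The bracket is a coefficient of \<open>(e(at) - 1) H(t)\<close> in degree
  \<open>k + 1\<close>; splitting off \<open>a t\<close> from \<open>e(at) - 1\<close> lowers the
  degree to \<open>k\<close> and leaves the factor \<open>a\<close>. In the theorem \<open>a\<close>
  is \<open>1/m\<close>; \<open>Suc \<alpha>\<close> avoids truncated subtraction.\<close>

lemma q_genocchi_bracket_eq:
  fixes q y a :: complex
  assumes q: "norm q < 1"
  shows "2 * q_bracket q (k + 1)
            * (\<Sum>j=0..k. q_binomial q k j * q_add_power q a (-1) (k - j) * q_genocchi q \<alpha> j 0 y)
          - (\<Sum>j=0..k+1. q_binomial q (k + 1) j * q_add_power q a (-1) (k + 1 - j)
                         * q_genocchi q (Suc \<alpha>) j 0 y)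
          - q_genocchi q (Suc \<alpha>) (k + 1) 0 y
       = q_fact q (k + 1) * a
            * fps_nth (dilate a (fps_shift 1 (q_exp_fps q)) * q_genocchi_fps q (Suc \<alpha>) y) k"
proof -
  define A where "A = dilate a (q_exp_fps q) * dilate (-1) (q_Exp_fps q)"
  define G where "G = (\<lambda>\<beta>. q_genocchi_fps q \<beta> y)"
  have gen: "q_genocchi q \<beta> j 0 y = q_fact q j * fps_nth (G \<beta>) j" for \<beta> j
  proof -
    have "dilate 0 (q_exp_fps q) = 1"
      by (intro fps_ext) (simp add: fps_nth_compose_linear power_0_left)
    then show ?thesis
      by (simp add: q_genocchi_eq_fps_nth[OF q] G_def)
  qed
  have conv: "(\<Sum>j=0..l. q_binomial q l j * q_add_power q a (-1) (l - j) * q_genocchi q \<beta> j 0 y)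
      = q_fact q l * fps_nth (A * G \<beta>) l" for l \<beta>
    unfolding gen q_add_power_eq_fps_nth[OF q] A_def[symmetric] mult.commute[of A "G \<beta>"]
      q_fact_mult_fps_nth[OF q, of l "G \<beta>" A]
    by (simp only: mult_ac)
  \<comment> \<open>The relation \<open>e(t) E(-t) = 1\<close> collapses \<open>A e\<close> to
    \<open>e(at)\<close>.\<close>
  have "A * (q_exp_fps q + 1)
      = dilate a (q_exp_fps q) * (q_exp_fps q * dilate (-1) (q_Exp_fps q)) + A"
    by (simp add: A_def algebra_simps)
  also have "\<dots> = dilate a (q_exp_fps q) + A"
    by (simp add: q_exp_fps_mult_q_Exp_fps_minus[OF q])
  finally have Ae: "A * (q_exp_fps q + 1) = dilate a (q_exp_fps q) + A" .
  have "2 * fps_X * (A * G \<alpha>) = A * (2 * fps_X * G \<alpha>)"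
    by (simp add: mult_ac)
  also have "\<dots> = A * (q_exp_fps q + 1) * G (Suc \<alpha>)"
    unfolding G_def q_genocchi_fps_Suc[symmetric] by (simp only: mult.assoc)
  finally have AG: "2 * fps_X * (A * G \<alpha>) = (dilate a (q_exp_fps q) + A) * G (Suc \<alpha>)"
    by (simp only: Ae)
  have shift: "dilate a (q_exp_fps q) - 1
      = fps_X * (fps_const a * dilate a (fps_shift 1 (q_exp_fps q)))"
  proof (rule fps_ext)
    fix n
    show "fps_nth (dilate a (q_exp_fps q) - 1) n =
      fps_nth (fps_X * (fps_const a * dilate a (fps_shift 1 (q_exp_fps q)))) n"
      by (cases n) (simp_all add: fps_nth_compose_linear)
  qed
  \<comment> \<open>Multiplication by \<open>t\<close> moves the first sum from degree
    \<open>k\<close> to \<open>k + 1\<close>, where the other two terms live; \<open>[k+1]_q\<close>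
    completes the factorial.\<close>
  have "2 * q_bracket q (k + 1) * (q_fact q k * fps_nth (A * G \<alpha>) k)
      = q_fact q (k + 1) * fps_nth (fps_const 2 * (fps_X * (A * G \<alpha>))) (k + 1)"
    by (simp add: q_fact_Suc)
  also have "fps_const 2 * (fps_X * (A * G \<alpha>)) = 2 * fps_X * (A * G \<alpha>)"
    by (simp add: mult.assoc numeral_fps_const)
  finally have "2 * q_bracket q (k + 1) * (q_fact q k * fps_nth (A * G \<alpha>) k)
      - q_fact q (k + 1) * fps_nth (A * G (Suc \<alpha>)) (k + 1)
      - q_fact q (k + 1) * fps_nth (G (Suc \<alpha>)) (k + 1)
      = q_fact q (k + 1) * fps_nth ((dilate a (q_exp_fps q) - 1) * G (Suc \<alpha>)) (k + 1)"
    unfolding AG by (simp add: algebra_simps)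
  also have "(dilate a (q_exp_fps q) - 1) * G (Suc \<alpha>)
      = fps_X * (fps_const a * (dilate a (fps_shift 1 (q_exp_fps q)) * G (Suc \<alpha>)))"
    by (simp add: shift mult.assoc)
  finally show ?thesis
    unfolding conv unfolding gen by (simp add: G_def mult.assoc)
qed

section \<open>Multiplication by the Bernoulli series\<close>

theorem theorem4:
  fixes q x y :: complex and \<alpha> m n :: nat
  assumes "0 < norm q" and "norm q < 1" and "\<alpha> \<ge> 1" and "m \<ge> 1"
  shows "q_genocchi q \<alpha> n x y =
    (\<Sum>k=0..n. q_binomial q n k
       * (1 / (of_nat m powi (int n - int k - 1) * q_bracket q (k + 1)))
       * (2 * q_bracket q (k + 1)
            * (\<Sum>j=0..k. q_binomial q k j * q_add_power q (1 / of_nat m) (-1) (k - j)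
                         * q_genocchi q (\<alpha> - 1) j 0 y)
          - (\<Sum>j=0..k+1. q_binomial q (k + 1) j * q_add_power q (1 / of_nat m) (-1) (k + 1 - j)
                         * q_genocchi q \<alpha> j 0 y)
          - q_genocchi q \<alpha> (k + 1) 0 y)
       * q_bernoulli q 1 (n - k) (of_nat m * x) 0)"
proof -
  note q = assms(2)
  obtain \<beta> where \<beta>: "\<alpha> = Suc \<beta>"
    using assms(3) by (cases \<alpha>) auto
  define a where "a = 1 / (of_nat m :: complex)"
  have m: "of_nat m \<noteq> (0 :: complex)"
    using assms(4) by simp
  have a: "a \<noteq> 0" "of_nat m = inverse a"
    using m by (auto simp: a_def)
  define D where "D = fps_shift 1 (q_exp_fps q)"
  define G where "G = q_genocchi_fps q \<alpha> y"
  define B where "B = inverse D * dilate (inverse a * x) (q_exp_fps q)"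
  have D0: "fps_nth D 0 \<noteq> 0"
    by (simp add: D_def q_fact_neq_0[OF q] q_fact_def q_bracket_neq_0[OF q])
  \<comment> \<open>Scaling by \<open>a = 1/m\<close> turns \<open>e(mxt)\<close> into
    \<open>e(xt)\<close> and the Bernoulli denominator into \<open>D(at)\<close>, which cancels the
    factor left by the bracket.\<close>
  have "dilate a B = inverse (dilate a D) * dilate x (q_exp_fps q)"
    using a(1) by (simp add: B_def dilate_mult dilate_inverse[OF D0] dilate_dilate flip: mult.assoc)
  moreover have "inverse (dilate a D) * dilate a D = 1"
    by (rule inverse_mult_eq_1) (use D0 in simp)
  ultimately have cancel: "(dilate a D * G) * dilate a B = G * dilate x (q_exp_fps q)"
    by (metis (no_types, opaque_lifting) mult.assoc mult.commute mult_1)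
  \<comment> \<open>The factor \<open>1 / m^(n-k-1)\<close> equals \<open>a^(n-k) / a\<close>: its
    numerator scales the coefficient of \<open>B\<close>, its denominator cancels the
    \<open>a\<close> from the bracket, and \<open>[k+1]_q\<close> reduces \<open>[k+1]_q!\<close> to
    \<open>[k]_q!\<close>.\<close>
  have "q_binomial q n k * (1 / (of_nat m powi (int n - int k - 1) * q_bracket q (k + 1)))
       * (q_fact q (k + 1) * a * fps_nth (dilate a D * G) k)
       * (q_fact q (n - k) * fps_nth B (n - k))
     = q_binomial q n k * (q_fact q k * fps_nth (dilate a D * G) k)
       * (q_fact q (n - k) * fps_nth (dilate a B) (n - k))" if "k \<le> n" for k
  proof -
    \<comment> \<open>The exponent is -1 for \<open>k = n\<close>, so an integer power is
      needed.\<close>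
    have powi: "of_nat m powi (int n - int k - 1) = inverse (a ^ (n - k)) * a"
    proof -
      have "int n - int k - 1 = int (n - k) - 1"
        using that by simp
      then show ?thesis
        using a by (simp add: power_int_diff power_inverse divide_inverse del: of_nat_diff)
    qed
    show ?thesis
      unfolding powi fps_nth_compose_linear Suc_eq_plus1[symmetric] q_fact_Suc
      using a(1) q_bracket_neq_0[OF q, of "Suc k"] by (simp add: field_simps)
  qed
  then have "(\<Sum>k=0..n. q_binomial q n k
       * (1 / (of_nat m powi (int n - int k - 1) * q_bracket q (k + 1)))
       * (q_fact q (k + 1) * a * fps_nth (dilate a D * G) k)
       * (q_fact q (n - k) * fps_nth B (n - k)))
     = q_fact q n * fps_nth ((dilate a D * G) * dilate a B) n"
    unfolding q_fact_mult_fps_nth[OF q, of n "dilate a D * G"] by (intro sum.cong) auto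
  also have "\<dots> = q_genocchi q \<alpha> n x y"
    by (simp only: cancel q_genocchi_eq_fps_nth[OF q] flip: G_def)
  finally show ?thesis
    unfolding a_def[symmetric] \<beta> diff_Suc_1 q_genocchi_bracket_eq[OF q] q_bernoulli_eq_fps_nth[OF q]
    by (simp only: D_def G_def B_def \<beta> a(2))
qed

end
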